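(* Let $n$ and $k$ be positive integers with $n\ge 2k^2(k-1)$. Let $H$ be an induced subgraph of the Kneser graph $\operatorname{KG}(n,k)$ with at least $\frac{2k^2(k-1)}{n}\binom{n}{k}$ vertices. Then $\chi(H)=\chi_c(H)$.
   Context: $\operatorname{KG}(n,k)$ has as vertices all $k$-subsets of $[n]=\{1,\dots,n\}$, two adjacent iff disjoint. For positive integers $p,d$, the circular complete graph $K_{p/d}$ has vertex set $[p]$, with $i,j$ adjacent iff $d\le|i-j|\le p-d$; the circular chromatic number $\chi_c(G)$ is the infimum of $p/d$ over all $p,d$ admitting a homomorphism $G\to K_{p/d}$.
   Formalization: The infimum defining the circular chromatic number is taken only over p/d with d ≤ p, so a nonempty edgeless graph has value 1; over all positive p, d it would be 0 and the claim would fail for k = 1 and H a single vertex. *)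

theory Defs
  imports Complex_Main "Graph_Theory.Graph_Theory"
begin

text \<open>Undirected graphs are symmetric digraphs, as in the locale \<open>graph\<close>:
  an edge \<open>uv\<close> is the pair of arcs \<open>(u, v)\<close> and \<open>(v, u)\<close>.\<close>

definition kneser_graph :: "nat \<Rightarrow> nat \<Rightarrow> nat set pair_pre_digraph" where
  "kneser_graph n k =
     (let V = {A. A \<subseteq> {1..n} \<and> card A = k}
      in \<lparr> pverts = V, parcs = {(A, B). A \<in> V \<and> B \<in> V \<and> A \<inter> B = {}} \<rparr>)"

text \<open>The arithmetic is over the integers because \<open>p - d\<close> and \<open>i - j\<close> may be negative.\<close>

definition circular_complete_graph :: "nat \<Rightarrow> nat \<Rightarrow> nat pair_pre_digraph" where
  "circular_complete_graph p d =
     \<lparr> pverts = {1..p},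
       parcs = {(i, j). i \<in> {1..p} \<and> j \<in> {1..p} \<and>
                  int d \<le> \<bar>int i - int j\<bar> \<and> \<bar>int i - int j\<bar> \<le> int p - int d} \<rparr>"

definition graph_homomorphism ::
    "('a, 'b) pre_digraph \<Rightarrow> ('c, 'd) pre_digraph \<Rightarrow> ('a \<Rightarrow> 'c) \<Rightarrow> bool" where
  "graph_homomorphism G H f \<longleftrightarrow>
     (\<forall>v \<in> verts G. f v \<in> verts H) \<and> (\<forall>u v. u \<rightarrow>\<^bsub>G\<^esub> v \<longrightarrow> f u \<rightarrow>\<^bsub>H\<^esub> f v)"

definition proper_coloring :: "('a, 'b) pre_digraph \<Rightarrow> nat \<Rightarrow> ('a \<Rightarrow> nat) \<Rightarrow> bool" where
  "proper_coloring G m c \<longleftrightarrow>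
     (\<forall>v \<in> verts G. c v < m) \<and> (\<forall>u v. u \<rightarrow>\<^bsub>G\<^esub> v \<longrightarrow> c u \<noteq> c v)"

definition chromatic_number :: "('a, 'b) pre_digraph \<Rightarrow> nat" where
  "chromatic_number G = (LEAST m. \<exists>c. proper_coloring G m c)"

text \<open>A homomorphism from a graph with an edge to \<open>K\<^bsub>p/d\<^esub>\<close> already forces
  \<open>2 * d \<le> p\<close>, so the bound \<open>d \<le> p\<close> matters only for edgeless graphs. It gives a
  non-null edgeless graph the conventional value 1; without it the graphs \<open>K\<^bsub>1/d\<^esub>\<close>, which
  are single vertices, would give 0. The null graph maps to every \<open>K\<^bsub>p/d\<^esub>\<close>; its value is
  the infimum 0 of all positive fractions.\<close>

definition circular_chromatic_number :: "('a, 'b) pre_digraph \<Rightarrow> real" where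
  "circular_chromatic_number G =
     (if verts G = {} then 0
      else Inf {real p / real d | p d. 0 < d \<and> d \<le> p \<and>
                  (\<exists>f. graph_homomorphism G (with_proj (circular_complete_graph p d)) f)})"

end

theory Submission
  imports Defs
begin

text \<open>Let \<open>m = \<chi>(H)\<close> and suppose that \<open>H\<close> maps to \<open>K\<^bsub>p/d\<^esub>\<close> with \<open>p < m d\<close>. The colours split into \<open>m\<close>
  blocks of at most \<open>d\<close> consecutive colours, and each block induces an intersecting family.
  For \<open>k \<ge> 2\<close> we have \<open>m \<le> n - 2\<close>, so some block carries more than \<open>2 k C\<close> vertices, where
  \<open>C\<close> is the number of \<open>k\<close>-sets through two given points; its members then share a point \<open>x\<close>.
  Cut this block at a colour \<open>t\<close> such that the part up to \<open>t\<close> and the part from \<open>t\<close> on both carry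
  more than \<open>k C\<close> vertices. A vertex whose colour is at circular distance less than \<open>d\<close> from \<open>t\<close>
  meets every member of one of the two parts, and since at most \<open>k C\<close> of the sets through \<open>x\<close> meet a
  given \<open>k\<close>-set avoiding \<open>x\<close>, it contains \<open>x\<close>. So the \<open>2 d - 1\<close> colours around \<open>t\<close> can be merged
  into one, and the remaining \<open>p - (2 d - 1) \<le> (m - 2) d\<close> colours form \<open>m - 2\<close> blocks: \<open>H\<close> has an
  \<open>(m - 1)\<close>-colouring. For \<open>k = 1\<close> any used colour \<open>t\<close> works, as \<open>H\<close> is complete.\<close>

section \<open>Adjacency in circular complete graphs and induced Kneser subgraphs\<close>

lemma arc_circular_complete_graph:
  "i \<rightarrow>\<^bsub>with_proj (circular_complete_graph p d)\<^esub> j \<longleftrightarrow>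
     i \<in> {1..p} \<and> j \<in> {1..p} \<and>
     int d \<le> \<bar>int i - int j\<bar> \<and> \<bar>int i - int j\<bar> \<le> int p - int d"
  by (auto simp: circular_complete_graph_def arcs_ends_def arc_to_ends_def)

lemma verts_circular_complete_graph:
  "verts (with_proj (circular_complete_graph p d)) = {1..p}"
  by (simp add: circular_complete_graph_def)

lemma verts_kneser_graph:
  "verts (with_proj (kneser_graph n k)) = {A. A \<subseteq> {1..n} \<and> card A = k}"
  by (simp add: kneser_graph_def Let_def)

text \<open>\<open>H\<close> is an arbitrary \<open>pre_digraph\<close>, but compatibility with the
  Kneser graph forces its projections to be \<open>fst\<close> and \<open>snd\<close>, so its arcs
  are determined by its vertex set.\<close>

lemma arc_induced_subgraph_kneser_graph:
  assumes "induced_subgraph H (with_proj (kneser_graph n k))"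
  shows "A \<rightarrow>\<^bsub>H\<^esub> B \<longleftrightarrow> A \<in> verts H \<and> B \<in> verts H \<and> A \<inter> B = {}"
proof -
  let ?K = "with_proj (kneser_graph n k)"
  have sub: "verts H \<subseteq> verts ?K" and comp: "compatible ?K H"
    and arcs: "arcs H = {e \<in> arcs ?K. tail ?K e \<in> verts H \<and> head ?K e \<in> verts H}"
    using assms by (auto simp: induced_subgraph_def subgraph_def)
  have "tail H = fst" "head H = snd"
    using comp by (auto simp: compatible_def)
  then have "A \<rightarrow>\<^bsub>H\<^esub> B \<longleftrightarrow> (A, B) \<in> arcs H"
    by (force simp: arcs_ends_def arc_to_ends_def)
  also have "\<dots> \<longleftrightarrow> A \<in> verts H \<and> B \<in> verts H \<and> A \<inter> B = {}"
    using sub unfolding arcs by (auto simp: kneser_graph_def Let_def)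
  finally show ?thesis .
qed

section \<open>Chromatic and circular chromatic numbers\<close>

lemma chromatic_number_le: "proper_coloring G m c \<Longrightarrow> chromatic_number G \<le> m"
  unfolding chromatic_number_def by (rule Least_le) blast

lemma proper_coloring_chromatic_number:
  assumes "proper_coloring G m c"
  obtains c' where "proper_coloring G (chromatic_number G) c'"
proof -
  have "\<exists>c. proper_coloring G (chromatic_number G) c"
    unfolding chromatic_number_def by (rule LeastI_ex) (use assms in blast)
  then show thesis using that by blast
qed

text \<open>An \<open>m\<close>-colouring is a homomorphism to the graph with \<open>p = m\<close>,
  \<open>d = 1\<close>, so the infimum is a minimum attained at \<open>m\<close>. What remains to be
  shown is an inequality between natural numbers.\<close>

lemma circular_chromatic_number_eqI:
  assumes nonempty: "verts G \<noteq> {}"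
    and wf: "\<And>u v. u \<rightarrow>\<^bsub>G\<^esub> v \<Longrightarrow> u \<in> verts G \<and> v \<in> verts G"
    and col: "proper_coloring G m c"
    and lower: "\<And>p d f. 0 < d \<Longrightarrow> d \<le> p \<Longrightarrow>
      graph_homomorphism G (with_proj (circular_complete_graph p d)) f \<Longrightarrow> m * d \<le> p"
  shows "circular_chromatic_number G = real m"
proof -
  let ?S = "{real p / real d | p d. 0 < d \<and> d \<le> p \<and>
    (\<exists>f. graph_homomorphism G (with_proj (circular_complete_graph p d)) f)}"
  from nonempty col have "m > 0"
    by (fastforce simp: proper_coloring_def)
  have "graph_homomorphism G (with_proj (circular_complete_graph m 1)) (\<lambda>v. c v + 1)"
    unfolding graph_homomorphism_def verts_circular_complete_graph arc_circular_complete_graph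
  proof (intro conjI ballI allI impI)
    fix v assume "v \<in> verts G"
    then show "c v + 1 \<in> {1..m}" using col by (auto simp: proper_coloring_def)
  next
    fix u v assume uv: "u \<rightarrow>\<^bsub>G\<^esub> v"
    then have "c u < m" "c v < m" "c u \<noteq> c v"
      using col wf[OF uv] by (auto simp: proper_coloring_def)
    then show "c u + 1 \<in> {1..m}" "c v + 1 \<in> {1..m}"
      "int 1 \<le> \<bar>int (c u + 1) - int (c v + 1)\<bar>"
      "\<bar>int (c u + 1) - int (c v + 1)\<bar> \<le> int m - int 1"
      by auto
  qed
  then have "real m / real 1 \<in> ?S"
    using \<open>m > 0\<close> by (intro CollectI exI[of _ m] exI[of _ 1]) auto
  then have "real m \<in> ?S" by simp
  moreover have "real m \<le> r" if "r \<in> ?S" for r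
  proof -
    from that obtain p d f where r: "r = real p / real d" and "0 < d" "d \<le> p"
      and "graph_homomorphism G (with_proj (circular_complete_graph p d)) f" by blast
    then have "m * d \<le> p" by (intro lower)
    then have "real m * real d \<le> real p" by (metis of_nat_le_iff of_nat_mult)
    then show ?thesis using \<open>0 < d\<close> by (simp add: r field_simps)
  qed
  ultimately have "Inf ?S = real m" by (rule cInf_eq_minimum)
  then show ?thesis
    using nonempty by (simp add: circular_chromatic_number_def)
qed

section \<open>Recolouring around one colour\<close>

text \<open>The colours at circular distance at least \<open>d\<close> from \<open>t\<close> form an arc of length at most
  \<open>(m - 2) * d\<close>, which splits into \<open>m - 2\<close> independent blocks.\<close>

lemma proper_coloring_if_independent_near:
  assumes hom: "graph_homomorphism G (with_proj (circular_complete_graph p d)) f"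
    and wf: "\<And>u v. u \<rightarrow>\<^bsub>G\<^esub> v \<Longrightarrow> u \<in> verts G \<and> v \<in> verts G"
    and d: "0 < d" "d \<le> p" and p: "p < m * d" and t: "t \<in> {1..p}"
    and near: "\<And>u v. u \<rightarrow>\<^bsub>G\<^esub> v \<Longrightarrow> 
       \<not> (int d \<le> \<bar>int (f u) - int t\<bar> \<and> \<bar>int (f u) - int t\<bar> \<le> int p - int d) \<Longrightarrow>
       \<not> (int d \<le> \<bar>int (f v) - int t\<bar> \<and> \<bar>int (f v) - int t\<bar> \<le> int p - int d) \<Longrightarrow> False"
  obtains c where "proper_coloring G (m - 1) c"
proof -
  define far where "far v \<longleftrightarrow> 
    int d \<le> \<bar>int (f v) - int t\<bar> \<and> \<bar>int (f v) - int t\<bar> \<le> int p - int d" for v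
  \<comment> \<open>The position of \<open>f v\<close> when counting cyclically from
    \<open>t\<close>, which has position 0.\<close>
  define off where "off v = (if t \<le> f v then f v - t else f v + p - t)" for v
  \<comment> \<open>Far positions start at \<open>d\<close> and are cut into blocks of length
    \<open>d\<close>; the last colour \<open>m - 2\<close> is reserved for the near
    vertices.\<close>
  define c where "c v = (if far v then (off v - d) div d else m - 2)" for v
  \<comment> \<open>This keeps the natural subtraction \<open>m - 2\<close> from truncating.\<close>
  have m2: "m \<ge> 2"
  proof (rule ccontr)
    assume "\<not> m \<ge> 2"
    then have "m * d \<le> 1 * d" by (intro mult_right_mono) auto
    with d p show False by simp
  qed
  have f: "f v \<in> {1..p}" if "v \<in> verts G" for v
    using hom that unfolding graph_homomorphism_def verts_circular_complete_graph by blast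
  have off: "d \<le> off v" "off v \<le> p - d" "off v - d < (m - 2) * d" if "v \<in> verts G" "far v" for v
  proof -
    show 1: "d \<le> off v" and 2: "off v \<le> p - d"
      using that(2) f[OF that(1)] t d unfolding far_def off_def by auto
    have "(m - 2) * d + 2 * d = m * d"
      using m2 by (metis add_mult_distrib le_add_diff_inverse2)
    then show "off v - d < (m - 2) * d" using 1 2 p d by linarith
  qed
  have "proper_coloring G (m - 1) c"
    unfolding proper_coloring_def
  proof (intro conjI ballI allI impI notI)
    fix v assume v: "v \<in> verts G"
    show "c v < m - 1"
    proof (cases "far v")
      case True
      then have "c v < m - 2" 
        using off(3)[OF v True] by (simp add: c_def less_mult_imp_div_less)
      then show ?thesis by simp
    qed (use m2 in \<open>simp add: c_def\<close>)
  next
    fix u v assume uv: "u \<rightarrow>\<^bsub>G\<^esub> v" and eq: "c u = c v"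
    have V: "u \<in> verts G" "v \<in> verts G" using wf[OF uv] by auto
    have far_iff: "far w \<longleftrightarrow> c w < m - 2" if "w \<in> verts G" for w
    proof (cases "far w")
      case True
      then show ?thesis
        using off(3)[OF that True] by (simp add: c_def less_mult_imp_div_less)
    qed (simp add: c_def)
    have adj: "int d \<le> \<bar>int (f u) - int (f v)\<bar>" "\<bar>int (f u) - int (f v)\<bar> \<le> int p - int d"
      using hom uv unfolding graph_homomorphism_def arc_circular_complete_graph by blast+
    show False
    proof (cases "far u \<or> far v")
      case False
      then show ?thesis using near[OF uv] unfolding far_def by blast
    next
      case True
      then have fars: "far u" "far v"
        using far_iff[OF V(1)] far_iff[OF V(2)] eq by simp_all
      then have "(off u - d) div d = (off v - d) div d" using eq by (simp add: c_def)
      moreover have "a < b + d" if "a div d = b div d" for a b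
      proof -
        have "a = b div d * d + a mod d" using that div_mult_mod_eq[of a d] by simp
        moreover have "a mod d < d" using d by simp
        moreover have "b div d * d \<le> b" by simp
        ultimately show ?thesis by linarith
      qed
      ultimately have "off u - d < off v - d + d" "off v - d < off u - d + d" by metis+
      then have "\<bar>int (off u) - int (off v)\<bar> < int d"
        using off(1)[OF V(1) fars(1)] off(1)[OF V(2) fars(2)] by linarith
      \<comment> \<open>Positions and colours differ by a constant modulo \<open>p\<close>. Two far
        vertices in one block thus have colours at circular distance less than \<open>d\<close>,
        which adjacency forbids.\<close>
      moreover have "int (off w) = int (f w) - int t \<or> int (off w) = int (f w) - int t + int p" for w
        using t unfolding off_def by auto
      from this[of u] this[of v]
      have "int (f u) - int (f v) - (int (off u) - int (off v)) \<in> {0, int p, - int p}"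
        by auto
      ultimately show False using adj by auto
    qed
  qed
  then show thesis by (rule that)
qed

section \<open>Counting sets through given points and intersecting families\<close>

text \<open>Removing \<open>S\<close> is a bijection onto the subsets of \<open>N - S\<close> of
  size \<open>k - card S\<close>.\<close>

lemma card_supersets_of_size:
  assumes "finite N" "S \<subseteq> N" "card S \<le> k"
  shows "card {A. A \<subseteq> N \<and> card A = k \<and> S \<subseteq> A} = (card N - card S) choose (k - card S)"
proof -
  have fS: "finite S" using assms finite_subset by blast
  have "bij_betw (\<lambda>A. A - S) {A. A \<subseteq> N \<and> card A = k \<and> S \<subseteq> A}
      {A. A \<subseteq> N - S \<and> card A = k - card S}"
  proof (rule bij_betwI[where g = "\<lambda>A. A \<union> S"])
    show "(\<lambda>A. A - S) \<in> {A. A \<subseteq> N \<and> card A = k \<and> S \<subseteq> A} \<rightarrow> {A. A \<subseteq> N - S \<and> card A = k - card S}"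
      using fS by (auto simp: card_Diff_subset)
    show "(\<lambda>A. A \<union> S) \<in> {A. A \<subseteq> N - S \<and> card A = k - card S} \<rightarrow> {A. A \<subseteq> N \<and> card A = k \<and> S \<subseteq> A}"
    proof safe
      fix A x assume A: "A \<subseteq> N - S" "card A = k - card S"
      have "finite A" using A assms finite_subset by (metis finite_Diff)
      then have "card (A \<union> S) = card A + card S"
        using A fS by (intro card_Un_disjoint) auto
      then show "card (A \<union> S) = k" using A assms by simp
    qed (use assms in auto)
  qed auto
  then have "card {A. A \<subseteq> N \<and> card A = k \<and> S \<subseteq> A} = card {A. A \<subseteq> N - S \<and> card A = k - card S}"
    by (rule bij_betw_same_card)
  also have "\<dots> = card (N - S) choose (k - card S)"
    by (rule n_subsets) (use assms in auto)
  finally show ?thesis using assms fS by (simp add: card_Diff_subset)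
qed

text \<open>Each member contains \<open>insert y S\<close> for some \<open>y\<close> in
  \<open>B\<close>, and \<open>y\<close> is new because \<open>S\<close> and \<open>B\<close> are
  disjoint; a union bound over \<open>y\<close> finishes.\<close>

lemma card_supersets_meeting_le:
  assumes N: "finite N" and F: "\<And>A. A \<in> F \<Longrightarrow> A \<subseteq> N \<and> card A = k \<and> S \<subseteq> A \<and> A \<inter> B \<noteq> {}"
    and S: "finite S" "card S < k" "S \<inter> B = {}" and B: "finite B"
  shows "card F \<le> card B * ((card N - card S - 1) choose (k - card S - 1))"
proof -
  let ?G = "\<lambda>y. {A. A \<subseteq> N \<and> card A = k \<and> insert y S \<subseteq> A}"
  have fin: "finite (?G y)" for y
    by (rule finite_subset[of _ "Pow N"]) (use N in auto)
  have "card F \<le> card (\<Union>y\<in>B. ?G y)"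
  proof (rule card_mono)
    show "finite (\<Union>y\<in>B. ?G y)" using B fin by (rule finite_UN_I)
    show "F \<subseteq> (\<Union>y\<in>B. ?G y)" using F by fast
  qed
  also have "\<dots> \<le> (\<Sum>y\<in>B. card (?G y))"
    by (rule card_UN_le[OF B])
  also have "\<dots> \<le> (\<Sum>y\<in>B. (card N - card S - 1) choose (k - card S - 1))"
  proof (rule sum_mono)
    fix y assume "y \<in> B"
    then have "y \<notin> S" using S by blast
    then have c: "card (insert y S) = card S + 1" using S by simp
    show "card (?G y) \<le> (card N - card S - 1) choose (k - card S - 1)"
    proof (cases "insert y S \<subseteq> N")
      case True
      then show ?thesis using card_supersets_of_size[OF N True] S c by simp
    next
      case False
      then have "?G y = {}" by blast
      then show ?thesis by (metis card.empty le0)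
    qed
  qed
  finally show ?thesis by simp
qed

text \<open>If every member of \<open>F\<close> contains \<open>x\<close> or \<open>y\<close>, those containing \<open>x\<close> meet a member avoiding \<open>x\<close>, and
  likewise for \<open>y\<close>. Otherwise branching gives at most \<open>k\<^sup>3\<close> triples, one of which lies in each
  member, and there are few sets through a triple because \<open>n\<close> is large.\<close>

lemma card_nontrivial_intersecting_le:
  assumes N: "finite N" "card N = n" and F: "\<And>A. A \<in> F \<Longrightarrow> A \<subseteq> N \<and> card A = k"
    and int: "\<And>A B. A \<in> F \<Longrightarrow> B \<in> F \<Longrightarrow> A \<inter> B \<noteq> {}"
    and nontriv: "\<And>x. \<exists>A\<in>F. x \<notin> A"
    and k: "2 \<le> k" and n: "2 * k^2 * (k - 1) \<le> n"
  shows "card F \<le> 2 * k * ((n - 2) choose (k - 2))"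
proof -
  have fin: "finite A" if "A \<in> F" for A using F[OF that] N finite_subset by blast
  have fF: "finite F" by (rule finite_subset[of _ "Pow N"]) (use F N in auto)
  show ?thesis
  proof (cases "\<exists>x y. \<forall>A\<in>F. x \<in> A \<or> y \<in> A")
    case True
    then obtain x y where xy: "\<forall>A\<in>F. x \<in> A \<or> y \<in> A" by blast
    have le: "card {A \<in> F. z \<in> A} \<le> k * ((n - 2) choose (k - 2))" for z
    proof -
      obtain B where B: "B \<in> F" "z \<notin> B" using nontriv by blast
      have "card {A \<in> F. z \<in> A} \<le> card B * ((card N - card {z} - 1) choose (k - card {z} - 1))"
        using F int B k fin by (intro card_supersets_meeting_le N) auto
      then show ?thesis using F[OF B(1)] N by (simp add: numeral_2_eq_2)
    qed
    have "card F = card ({A \<in> F. x \<in> A} \<union> {A \<in> F. y \<in> A})"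
      by (rule arg_cong[of _ _ card]) (use xy in blast)
    also have "\<dots> \<le> card {A \<in> F. x \<in> A} + card {A \<in> F. y \<in> A}"
      by (rule card_Un_le)
    finally show ?thesis using le[of x] le[of y] by simp
  next
    case False
    then have "\<forall>x y. \<exists>B\<in>F. x \<notin> B \<and> y \<notin> B" by blast
    then obtain B where B: "\<And>x y. B x y \<in> F" "\<And>x y. x \<notin> B x y" "\<And>x y. y \<notin> B x y" by metis
    obtain A0 where A0: "A0 \<in> F" using nontriv by blast
    \<comment> \<open>For \<open>k = 2\<close> the two points of \<open>A0\<close> would meet every
      member.\<close>
    have "k \<noteq> 2"
    proof
      assume "k = 2"
      then obtain a b where "A0 = {a, b}" using F[OF A0] by (metis card_2_iff)
      then show False using int[OF _ A0] False by blast
    qed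
    then have k3: "3 \<le> k" using k by simp
    let ?C = "(n - 3) choose (k - 3)"
    let ?G = "\<lambda>x y. {A \<in> F. x \<in> A \<and> y \<in> A}"
    \<comment> \<open>Members through \<open>x\<close> and \<open>y\<close> must meet
      \<open>B x y\<close>, which avoids both, so each contains a third point from it.\<close>
    have "card (?G x y) \<le> k * ?C" if "y \<in> B x x" for x y
    proof -
      have "x \<noteq> y" using that B by metis
      then have c: "card {x, y} = 2" by simp
      have "card (?G x y) \<le> card (B x y) * ((card N - card {x, y} - 1) choose (k - card {x, y} - 1))"
        using F int B k3 fin c by (intro card_supersets_meeting_le N) auto
      then show ?thesis using F[OF B(1)] N c by (simp add: numeral_3_eq_3)
    qed
    then have "(\<Sum>y\<in>B x x. card (?G x y)) \<le> (\<Sum>y\<in>B x x. k * ?C)" for x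
      by (intro sum_mono)
    then have le: "(\<Sum>y\<in>B x x. card (?G x y)) \<le> k * (k * ?C)" for x
      using F[OF B(1)] by simp
    have "F \<subseteq> (\<Union>x\<in>A0. \<Union>y\<in>B x x. ?G x y)"
    proof
      fix A assume A: "A \<in> F"
      then obtain x where x: "x \<in> A" "x \<in> A0" using int[OF A A0] by blast
      moreover obtain y where "y \<in> A" "y \<in> B x x" using int[OF A B(1)] by blast
      ultimately show "A \<in> (\<Union>x\<in>A0. \<Union>y\<in>B x x. ?G x y)" using A by blast
    qed
    then have "card F \<le> card (\<Union>x\<in>A0. \<Union>y\<in>B x x. ?G x y)"
      using fin A0 B(1) fF by (intro card_mono) auto
    also have "\<dots> \<le> (\<Sum>x\<in>A0. card (\<Union>y\<in>B x x. ?G x y))"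
      by (rule card_UN_le) (use fin A0 in blast)
    also have "\<dots> \<le> (\<Sum>x\<in>A0. \<Sum>y\<in>B x x. card (?G x y))"
      by (intro sum_mono card_UN_le fin B)
    also have "\<dots> \<le> (\<Sum>x\<in>A0. k * (k * ?C))"
      by (intro sum_mono le)
    also have "\<dots> = k * (k * (k * ?C))" using F[OF A0] by simp
    finally have card_F: "card F \<le> k * (k * (k * ?C))" .
    \<comment> \<open>Since \<open>?C\<close> is the fraction \<open>(k - 2) / (n - 2)\<close> of
      the number of \<open>k\<close>-sets through two points, this bound absorbs two of the three
      factors \<open>k\<close> in \<open>card_F\<close>.\<close>
    have n2: "k\<^sup>2 * (k - 2) \<le> n - 2"
    proof -
      have "k\<^sup>2 * (k - 2) + 2 \<le> k\<^sup>2 * (k - 2) + k\<^sup>2"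
        using k3 power_mono[of 3 k 2] by simp
      also have "\<dots> = k\<^sup>2 * Suc (k - 2)" by simp
      also have "\<dots> = k\<^sup>2 * (k - 1)" using k3 by (intro arg_cong[of _ _ "(*) _"]) simp
      also have "\<dots> \<le> 2 * k\<^sup>2 * (k - 1)" by simp
      also note n
      finally show ?thesis by simp
    qed
    have "0 < k\<^sup>2 * (k - 2)" using k3 by simp
    then have "0 < n - 2" using n2 by linarith
    have absorb: "(n - 2) * ?C = (k - 2) * ((n - 2) choose (k - 2))"
    proof -
      have "Suc (k - 3) = k - 2" "Suc (n - 3) = n - 2" using k3 \<open>0 < n - 2\<close> by auto
      then show ?thesis using Suc_times_binomial_eq[of "n - 3" "k - 3"]
        by (simp add: mult.commute)
    qed
    have "(n - 2) * card F \<le> (n - 2) * (k * (k * (k * ?C)))"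
      using card_F by (rule mult_left_mono) simp
    also have "\<dots> = k * (k\<^sup>2 * ((n - 2) * ?C))"
      by (simp only: power2_eq_square mult_ac)
    also have "\<dots> = (k\<^sup>2 * (k - 2)) * (k * ((n - 2) choose (k - 2)))"
      unfolding absorb by (simp only: mult_ac)
    also have "\<dots> \<le> (n - 2) * (2 * k * ((n - 2) choose (k - 2)))"
      using n2 by (intro mult_mono) auto
    finally show ?thesis using \<open>0 < n - 2\<close> by simp
  qed
qed

section \<open>Cutting a block, and colouring with \<open>n - 2\<close> colours\<close>

text \<open>For the least \<open>t\<close> with more than \<open>M\<close> values up to
  \<open>t\<close>, at most \<open>M\<close> values lie strictly below \<open>t\<close>, leaving
  more than \<open>M\<close> from \<open>t\<close> on.\<close>

lemma split_card:
  fixes f :: "'a \<Rightarrow> nat"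
  assumes "finite X" "2 * M < card X"
  obtains t where "M < card {v \<in> X. f v \<le> t}" "M < card {v \<in> X. t \<le> f v}"
proof -
  define P where "P t \<longleftrightarrow> M < card {v \<in> X. f v \<le> t}" for t
  have "{v \<in> X. f v \<le> Max (f ` X)} = X" using assms by auto
  then have ex: "P (Max (f ` X))" using assms unfolding P_def by simp
  define t where "t = (LEAST t. P t)"
  have "P t" unfolding t_def by (rule LeastI) (rule ex)
  have "card {v \<in> X. f v < t} \<le> M"
  proof (cases t)
    case (Suc s)
    then have "\<not> P s" unfolding t_def by (metis not_less_Least lessI)
    then show ?thesis by (simp add: Suc P_def less_Suc_eq_le)
  qed simp
  moreover have "card {v \<in> X. f v < t} + card {v \<in> X. t \<le> f v} = card X"
    using assms by (subst card_Un_disjoint[symmetric]) (auto intro!: arg_cong[of _ _ card])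
  ultimately have "M < card {v \<in> X. t \<le> f v}" using assms by linarith
  with \<open>P t\<close> show thesis using that unfolding P_def by blast
qed

text \<open>The sets with minimum at least \<open>n - 2\<close> pairwise meet, since they lie in a set of size 3.\<close>

lemma proper_coloring_kneser_graph:
  assumes H: "induced_subgraph H (with_proj (kneser_graph n k))" and k: "2 \<le> k" and n: "3 \<le> n"
  shows "proper_coloring H (n - 2) (\<lambda>A. min (Min A) (n - 2) - 1)"
proof -
  have V: "A \<subseteq> {1..n} \<and> card A = k \<and> finite A \<and> A \<noteq> {} \<and> Min A \<in> A" if "A \<in> verts H" for A
  proof -
    have A: "A \<subseteq> {1..n}" "card A = k"
      using H that verts_kneser_graph by (auto simp: induced_subgraph_def subgraph_def)
    then have "finite A" "A \<noteq> {}" using k finite_subset by auto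
    then show ?thesis using A by simp
  qed
  show ?thesis
    unfolding proper_coloring_def arc_induced_subgraph_kneser_graph[OF H]
  proof (intro conjI ballI allI impI notI)
    fix A assume "A \<in> verts H"
    then show "min (Min A) (n - 2) - 1 < n - 2" using n by auto
  next
    fix A B
    assume AB: "A \<in> verts H \<and> B \<in> verts H \<and> A \<inter> B = {}"
      and eq: "min (Min A) (n - 2) - 1 = min (Min B) (n - 2) - 1"
    \<comment> \<open>Positive values stay distinct after subtracting 1, so distinct minima get
      equal colours only if both are capped at \<open>n - 2\<close>.\<close>
    have *: "n - 2 \<le> a" if "1 \<le> a" "1 \<le> b" "a \<noteq> b" "min a (n - 2) - 1 = min b (n - 2) - 1"
      for a b using that n by linarith
    have min: "1 \<le> Min A" "1 \<le> Min B"
      using V[of A] V[of B] AB by (meson atLeastAtMost_iff subsetD)+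
    have neq: "Min A \<noteq> Min B"
      using V[of A] V[of B] AB by (metis disjoint_iff)
    have sub: "A \<subseteq> {n - 2..n}" if "A \<in> verts H" "n - 2 \<le> Min A" for A
    proof
      fix a assume a: "a \<in> A"
      then have "Min A \<le> a" using V[OF that(1)] by (intro Min_le) auto
      moreover have "a \<le> n" using V[OF that(1)] a by auto
      ultimately show "a \<in> {n - 2..n}" using that(2) by simp
    qed
    have "A \<subseteq> {n - 2..n}" using AB *[OF min neq eq] by (intro sub) auto
    moreover have "B \<subseteq> {n - 2..n}"
      using AB *[OF min(2,1) neq[symmetric] eq[symmetric]] by (intro sub) auto
    ultimately have "A \<union> B \<subseteq> {n - 2..n}" by (rule Un_least)
    then have "card (A \<union> B) \<le> card {n - 2..n}" by (intro card_mono) auto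
    moreover have "card (A \<union> B) = card A + card B"
      using V[of A] V[of B] AB by (intro card_Un_disjoint) auto
    ultimately show False using V[of A] V[of B] AB k n by simp
  qed
qed

section \<open>From a circular colouring below \<open>m\<close> to \<open>m - 1\<close>
  colours\<close>

theorem theorem11:
  fixes n k :: nat
    and H :: "(nat set, nat set \<times> nat set) pre_digraph"
  assumes "0 < n" and "0 < k"
    and "2 * k^2 * (k - 1) \<le> n"
    and "induced_subgraph H (with_proj (kneser_graph n k))"
    and "2 * real k^2 * (real k - 1) / real n * real (n choose k) \<le> real (card (verts H))"
  shows "real (chromatic_number H) = circular_chromatic_number H"
proof (cases "verts H = {}")
  case True
  then have "proper_coloring H 0 (\<lambda>_. 0)"
    by (simp add: proper_coloring_def arc_induced_subgraph_kneser_graph[OF assms(4)])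
  then have "chromatic_number H = 0" using chromatic_number_le by fastforce
  then show ?thesis using True by (simp add: circular_chromatic_number_def)
next
  case nonempty: False
  note arc = arc_induced_subgraph_kneser_graph[OF assms(4)]
  have V: "A \<subseteq> {1..n}" "card A = k" if "A \<in> verts H" for A
    using assms(4) that verts_kneser_graph by (auto simp: induced_subgraph_def subgraph_def)
  have Vfin: "finite A" if "A \<in> verts H" for A using V[OF that] finite_subset by blast
  have finV: "finite (verts H)" by (rule finite_subset[of _ "Pow {1..n}"]) (use V in auto)
  define m where "m = chromatic_number H"
  have "\<exists>c. proper_coloring H m c"
  proof -
    \<comment> \<open>Numbering the vertices is a proper colouring, as no vertex is disjoint from
      itself for \<open>k > 0\<close>; hence the least number of colours is attained.\<close>
    obtain h :: "nat set \<Rightarrow> nat" where h: "inj_on h (verts H)" "h ` verts H = {0..<card (verts H)}"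
      using ex_bij_betw_finite_nat[OF finV] by (auto simp: bij_betw_def)
    have "proper_coloring H (card (verts H)) h"
      unfolding proper_coloring_def arc
    proof (intro conjI ballI allI impI notI)
      fix A B assume "A \<in> verts H \<and> B \<in> verts H \<and> A \<inter> B = {}" "h A = h B"
      then have "A = {}" "A \<in> verts H" using h(1) by (auto dest: inj_onD)
      then show False using V(2) assms(2) by fastforce
    qed (use h in auto)
    then show ?thesis unfolding m_def using proper_coloring_chromatic_number by metis
  qed
  then obtain c where c: "proper_coloring H m c" by blast
  have "m > 0" using c nonempty by (fastforce simp: proper_coloring_def)
  have "m * d \<le> p" if d: "0 < d" "d \<le> p"
    and hom: "graph_homomorphism H (with_proj (circular_complete_graph p d)) f" for p d f
  proof (rule ccontr)
    assume "\<not> m * d \<le> p"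
    then have p: "p < m * d" by simp
    have f: "f A \<in> {1..p}" if "A \<in> verts H" for A
      using hom that unfolding graph_homomorphism_def verts_circular_complete_graph by blast
    have adj: "int d \<le> \<bar>int (f A) - int (f B)\<bar> \<and> \<bar>int (f A) - int (f B)\<bar> \<le> int p - int d"
      if "A \<in> verts H" "B \<in> verts H" "A \<inter> B = {}" for A B
      using hom that unfolding graph_homomorphism_def arc_circular_complete_graph arc by blast
    \<comment> \<open>A colour \<open>t\<close> whose near vertices share a point: they then
      pairwise intersect and can be merged into one class.\<close>
    have "\<exists>x. \<exists>t\<in>{1..p}. \<forall>A\<in>verts H.
      \<not> (int d \<le> \<bar>int (f A) - int t\<bar> \<and> \<bar>int (f A) - int t\<bar> \<le> int p - int d) \<longrightarrow> x \<in> A"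
    proof (cases "k = 1")
      case True
      obtain A0 where A0: "A0 \<in> verts H" using nonempty by blast
      then obtain x where x: "A0 = {x}" using V True by (metis card_1_singletonE)
      show ?thesis
      proof (intro exI bexI ballI impI)
        fix A assume A: "A \<in> verts H"
          "\<not> (int d \<le> \<bar>int (f A) - int (f A0)\<bar> \<and> \<bar>int (f A) - int (f A0)\<bar> \<le> int p - int d)"
        then have "A \<inter> A0 \<noteq> {}" using adj A0 by blast
        then show "x \<in> A" using x by simp
      qed (rule f[OF A0])
    next
      case False
      then have k: "2 \<le> k" using assms(2) by simp
      have "2 * 2^2 * 1 \<le> 2 * k^2 * (k - 1)"
        using k by (intro mult_mono power_mono) auto
      also note assms(3)
      finally have n8: "8 \<le> n" by simp
      have "k * 1 \<le> k^2 * (k - 1)" unfolding power2_eq_square using k 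
        by (intro mult_mono) auto
      then have kn: "k \<le> n" using assms(3) by simp
      define C where "C = (n - 2) choose (k - 2)"
      have "C > 0" unfolding C_def using kn by simp
      \<comment> \<open>Absorbing \<open>k\<close> and then \<open>k - 1\<close> into the binomial
        coefficient turns the assumed bound into exactly \<open>2 * k * (n - 1) * C\<close>.\<close>
      have cardV: "2 * k * (n - 1) * C \<le> card (verts H)"
      proof -
        have "k * (n choose k) = n * ((n - 1) choose (k - 1))"
          using k n8 by (intro times_binomial_minus1_eq) auto
        moreover have "(k - 1) * ((n - 1) choose (k - 1)) = (n - 1) * C"
          using k n8 times_binomial_minus1_eq[of "k - 1" "n - 1"] by (simp add: C_def numeral_2_eq_2)
        ultimately have "(k - 1) * (k * (n choose k)) = n * ((n - 1) * C)"
          by (simp add: ac_simps)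
        then have "real ((k - 1) * (k * (n choose k))) = real (n * ((n - 1) * C))"
          by simp
        then have "(real k - 1) * (real k * real (n choose k)) = real n * (real (n - 1) * real C)"
          using k by (simp add: of_nat_diff)
        moreover have "2 * real k^2 * (real k - 1) / real n * real (n choose k) =
            2 * real k * ((real k - 1) * (real k * real (n choose k))) / real n"
          by (simp add: power2_eq_square)
        ultimately have "2 * real k^2 * (real k - 1) / real n * real (n choose k) =
            2 * real k * (real (n - 1) * real C)"
          using assms(1) by simp
        also have "\<dots> = real (2 * k * (n - 1) * C)" by simp
        finally have "real (2 * k * (n - 1) * C) \<le> real (card (verts H))"
          using assms(5) by (simp only:)
        then show ?thesis by (simp only: of_nat_le_iff)
      qed
      have "m \<le> n - 2"
        unfolding m_def
        by (rule chromatic_number_le[OF proper_coloring_kneser_graph[OF assms(4) k]]) (use n8 in simp)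
      \<comment> \<open>Colours start at 1, hence the shift before the division.\<close>
      define X where "X j = {A \<in> verts H. (f A - 1) div d = j}" for j
      \<comment> \<open>Pigeonhole: \<open>m \<le> n - 2\<close> blocks of at most
        \<open>2 * k * C\<close> vertices would fall short of \<open>cardV\<close>.\<close>
      have "\<exists>j<m. 2 * (k * C) < card (X j)"
      proof (rule ccontr)
        assume "\<not> (\<exists>j<m. 2 * (k * C) < card (X j))"
        then have le: "card (X j) \<le> 2 * (k * C)" if "j < m" for j using that by (meson not_less)
        have "verts H \<subseteq> (\<Union>j<m. X j)"
        proof
          fix A assume A: "A \<in> verts H"
          then have "f A - 1 < m * d" using f p by fastforce
          then have "(f A - 1) div d < m" by (simp add: less_mult_imp_div_less)
          then show "A \<in> (\<Union>j<m. X j)" using A by (auto simp: X_def)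
        qed
        then have "card (verts H) \<le> card (\<Union>j<m. X j)"
          using finV by (intro card_mono) (auto simp: X_def)
        also have "\<dots> \<le> (\<Sum>j<m. card (X j))" by (rule card_UN_le) simp
        also have "\<dots> \<le> (\<Sum>j<m. 2 * (k * C))" using le by (intro sum_mono) auto
        also have "\<dots> = m * (2 * k * C)" by simp
        also have "\<dots> < (n - 1) * (2 * k * C)"
          by (rule mult_strict_right_mono) (use \<open>m \<le> n - 2\<close> n8 \<open>C > 0\<close> k in simp_all)
        also have "\<dots> = 2 * k * (n - 1) * C" by (simp only: mult_ac)
        finally show False using cardV by simp
      qed
      then obtain j where j: "2 * (k * C) < card (X j)" by blast
      have XV: "X j \<subseteq> verts H" by (auto simp: X_def)
      have Xclose: "\<bar>int (f A) - int (f B)\<bar> < int d" if "A \<in> X j" "B \<in> X j" for A B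
      proof -
        have "f A - 1 = j * d + (f A - 1) mod d" "f B - 1 = j * d + (f B - 1) mod d"
          using that div_mult_mod_eq[of "f A - 1" d] div_mult_mod_eq[of "f B - 1" d]
          unfolding X_def by auto
        moreover have "(f A - 1) mod d < d" "(f B - 1) mod d < d" using d by auto
        moreover have "1 \<le> f A" "1 \<le> f B" using f XV that by fastforce+
        ultimately show ?thesis by linarith
      qed
      have "\<exists>x. \<forall>A\<in>X j. x \<in> A"
      proof (rule ccontr)
        assume nt: "\<not> (\<exists>x. \<forall>A\<in>X j. x \<in> A)"
        have "card (X j) \<le> 2 * k * ((n - 2) choose (k - 2))"
        proof (rule card_nontrivial_intersecting_le[of "{1..n}"])
          fix A B assume AB: "A \<in> X j" "B \<in> X j"
          then show "A \<inter> B \<noteq> {}" using adj[of A B] Xclose[OF AB] XV by auto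
        qed (use V XV nt k assms(3) in auto)
        then show False using j by (simp add: C_def)
      qed
      then obtain x where x: "\<And>A. A \<in> X j \<Longrightarrow> x \<in> A" by blast
      have large_star: "x \<in> A"
        if "A \<in> verts H" "Y \<subseteq> X j" "k * C < card Y" "\<And>B. B \<in> Y \<Longrightarrow> A \<inter> B \<noteq> {}" for A Y
      proof (rule ccontr)
        assume "x \<notin> A"
        then have "card Y \<le> card A * ((card {1..n} - card {x} - 1) choose (k - card {x} - 1))"
        proof (intro card_supersets_meeting_le)
          fix B assume "B \<in> Y"
          then have "B \<in> X j" "A \<inter> B \<noteq> {}" using that by auto
          moreover from this have "B \<in> verts H" using XV by blast
          ultimately show "B \<subseteq> {1..n} \<and> card B = k \<and> {x} \<subseteq> B \<and> B \<inter> A \<noteq> {}"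
            using V x by (simp add: Int_commute)
        qed (use k Vfin[OF that(1)] \<open>x \<notin> A\<close> in simp_all)
        then show False using that(3) V(2)[OF that(1)] by (simp add: C_def numeral_2_eq_2)
      qed
      have finX: "finite (X j)" using finV XV finite_subset by blast
      obtain t where t: "k * C < card {B \<in> X j. f B \<le> t}" "k * C < card {B \<in> X j. t \<le> f B}"
        by (rule split_card[OF finX j])
      \<comment> \<open>\<open>B1\<close> and \<open>B2\<close> enclose \<open>t\<close> in the
        colour range of the block, so every colour of the block is within less than \<open>d\<close>
        of \<open>t\<close>.\<close>
      obtain B1 where B1: "B1 \<in> X j" "f B1 \<le> t"
        using t(1) by (metis (mono_tags, lifting) Collect_empty_eq card.empty not_less0)
      obtain B2 where B2: "B2 \<in> X j" "t \<le> f B2"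
        using t(2) by (metis (mono_tags, lifting) Collect_empty_eq card.empty not_less0)
      have "t \<in> {1..p}" using f[of B1] f[of B2] B1 B2 XV by auto
      moreover have "x \<in> A" if A: "A \<in> verts H" and
        near: "\<not> (int d \<le> \<bar>int (f A) - int t\<bar> \<and> \<bar>int (f A) - int t\<bar> \<le> int p - int d)" for A
      proof -
        have meets: "A \<inter> B \<noteq> {}" if "B \<in> X j"
          "\<bar>int (f A) - int (f B)\<bar> < int d \<or> int p - int d < \<bar>int (f A) - int (f B)\<bar>" for B
        proof
          assume "A \<inter> B = {}"
          moreover have "B \<in> verts H" using XV that(1) by blast
          ultimately show False using adj[OF A] that(2) by fastforce
        qed
        \<comment> \<open>Without wrap-around, compare \<open>A\<close> with the part on its own
          side of \<open>t\<close>: both colours lie within \<open>d\<close> of \<open>t\<close> on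
          that side. With wrap-around, take the other part, whose colours are even further from
          \<open>f A\<close> than \<open>t\<close> is, or equally far.\<close>
        consider (right) "t \<le> f A" "int (f A) - int t < int d"
          | (right_wrap) "t \<le> f A" "int p - int d < int (f A) - int t"
          | (left) "f A \<le> t" "int t - int (f A) < int d"
          | (left_wrap) "f A \<le> t" "int p - int d < int t - int (f A)"
          using near by linarith
        then show ?thesis
        proof cases
          case right
          have "A \<inter> B \<noteq> {}" if "B \<in> X j" "t \<le> f B" for B
            by (intro meets that(1)) (use that right Xclose[OF that(1) B1(1)] B1(2) in linarith)
          then show ?thesis using t(2) by (intro large_star[OF A, of "{B \<in> X j. t \<le> f B}"]) auto
        next
          case right_wrap
          have "A \<inter> B \<noteq> {}" if "B \<in> X j" "f B \<le> t" for B
            by (intro meets that(1)) (use that right_wrap in linarith)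
          then show ?thesis using t(1) by (intro large_star[OF A, of "{B \<in> X j. f B \<le> t}"]) auto
        next
          case left
          have "A \<inter> B \<noteq> {}" if "B \<in> X j" "f B \<le> t" for B
            by (intro meets that(1)) (use that left Xclose[OF that(1) B2(1)] B2(2) in linarith)
          then show ?thesis using t(1) by (intro large_star[OF A, of "{B \<in> X j. f B \<le> t}"]) auto
        next
          case left_wrap
          have "A \<inter> B \<noteq> {}" if "B \<in> X j" "t \<le> f B" for B
            by (intro meets that(1)) (use that left_wrap in linarith)
          then show ?thesis using t(2) by (intro large_star[OF A, of "{B \<in> X j. t \<le> f B}"]) auto
        qed
      qed
      ultimately show ?thesis by blast
    qed
    then obtain x t where t: "t \<in> {1..p}" and near: "\<And>A. A \<in> verts H \<Longrightarrow>
      \<not> (int d \<le> \<bar>int (f A) - int t\<bar> \<and> \<bar>int (f A) - int t\<bar> \<le> int p - int d) \<Longrightarrow> x \<in> A" by blast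
    obtain c' where "proper_coloring H (m - 1) c'"
      by (rule proper_coloring_if_independent_near[OF hom _ d p t])
        (use near arc in blast)+
    then have "m \<le> m - 1" unfolding m_def by (rule chromatic_number_le)
    then show False using \<open>m > 0\<close> by simp
  qed
  then have "circular_chromatic_number H = real m"
    using arc by (intro circular_chromatic_number_eqI[OF nonempty _ c]) blast+
  then show ?thesis by (simp add: m_def)
qed

end
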